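(* Let $X$ and $Y$ be real locally convex Hausdorff topological vector spaces with topological duals $X^{\ast}$ and $Y^{\ast}$, $U$ an uncertainty (index) set, and $F_{u}\colon X\times Y\to\overline{\mathbb{R}}=\mathbb{R}\cup\{\pm\infty\}$, $u\in U$, a family of functions. Let $$\mathcal{F}^{\#}:=\left\{(x',s)\in X^{\ast}\times\mathbb{R}:\exists(u,\mu)\in U\times Y^{\ast},\ (F_{u})^{\ast}(x',\mu)\leq s\right\}.$$ Consider the following statements: (i) The robust $S_{\{F_{u}\}_{u\in U}}$-procedure is valid. (ii) The robust $S_{\{(F_{u})^{\ast\ast}\}_{u\in U}}$-procedure is valid. (iii) $\mathcal{F}^{\#}$ is weak*-closed convex regarding $\{(0_{X^{\ast}},0)\}$. Then (i) $\Rightarrow$ (ii) $\Rightarrow$ (iii). If, moreover, $$\inf_{x\in X}\sup_{u\in U}F_{u}(x,0_{Y})=\inf_{x\in X}\sup_{u\in U}(F_{u})^{\ast\ast}(x,0_{Y})\neq+\infty,$$ then (i) $\Leftrightarrow$ (ii) $\Leftrightarrow$ (iii).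
   Context: $X^{\ast}$ and $X^{\ast}\times\mathbb{R}$ carry the weak*-topology; $\langle\cdot,\cdot\rangle$ denotes the duality products; $0_{Y}$, $0_{X^{\ast}}$ are the null vectors. Fenchel conjugates: for $F\colon X\times Y\to\overline{\mathbb{R}}$, $F^{\ast}(x',\mu)=\sup_{(x,y)\in X\times Y}\{\langle x',x\rangle+\langle\mu,y\rangle-F(x,y)\}$ for $(x',\mu)\in X^{\ast}\times Y^{\ast}$, and the biconjugate, considered on $X\times Y$, is $F^{\ast\ast}(x,y)=\sup_{(x',\mu)\in X^{\ast}\times Y^{\ast}}\{\langle x',x\rangle+\langle\mu,y\rangle-F^{\ast}(x',\mu)\}$. For a family $G_{u}\colon X\times Y\to\overline{\mathbb{R}}$, $u\in U$, the robust $S_{\{G_{u}\}_{u\in U}}$-procedure concerns the two statements $(\mathfrak{A})$: $\sup_{u\in U}G_{u}(x,0_{Y})\geq 0$ for all $x\in X$; $(\mathfrak{B})$: there exists $(\bar u,\bar\lambda)\in U\times Y^{\ast}$ such that $G_{\bar u}(x,y)+\langle\bar\lambda,y\rangle\geq 0$ for all $(x,y)\in X\times Y$. One always has $(\mathfrak{B})\Rightarrow(\mathfrak{A})$. The procedure is said to be valid if $(\mathfrak{A})\Rightarrow(\mathfrak{B})$ (equivalently, $(\mathfrak{A})\Leftrightarrow(\mathfrak{B})$). A subset $C$ of a locally convex space is closed convex regarding a subset $D$ of the same space if $(\overline{\operatorname{co}}\,C)\cap D=C\cap D$, where $\overline{\operatorname{co}}\,C$ is the closure of the convex hull of $C$;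 "weak*-closed convex regarding" means that the closure is taken in the weak*-topology. *)

theory Defs
  imports "HOL-Analysis.Analysis"
begin

section \<open>Locally convex Hausdorff spaces\<close>

class locally_convex_t2 = real_vector + topological_ab_group_add + t2_space +
  assumes tendsto_scaleR_nhds:
    "((\<lambda>p. fst p *\<^sub>R snd p) \<longlongrightarrow> a *\<^sub>R x) (nhds a \<times>\<^sub>F nhds x)"
  \<comment> \<open>\<^const>\<open>convex\<close> is unfolded, since its sort constraint rules it out inside a class specification.\<close>
  assumes locally_convex_0_unfolded:
    "open S \<Longrightarrow> 0 \<in> S \<Longrightarrow> \<exists>V. open V \<and>
      (\<forall>x\<in>V. \<forall>y\<in>V. \<forall>u\<ge>0. \<forall>v\<ge>0. u + v = 1 \<longrightarrow> u *\<^sub>R x + v *\<^sub>R y \<in> V) \<and> 0 \<in> V \<and> V \<subseteq> S"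

lemma locally_convex_0:
  fixes S :: "'a::locally_convex_t2 set"
  assumes "open S" "0 \<in> S"
  shows "\<exists>V. open V \<and> convex V \<and> 0 \<in> V \<and> V \<subseteq> S"
  using locally_convex_0_unfolded[OF assms] unfolding convex_def .

instance real_normed_vector \<subseteq> locally_convex_t2
proof
  fix a :: real and x :: 'a
  have "filterlim fst (nhds a) (nhds a \<times>\<^sub>F nhds x)"
    and "filterlim snd (nhds x) (nhds a \<times>\<^sub>F nhds x)"
    by (rule filterlim_fst filterlim_snd)+
  then show "((\<lambda>p. fst p *\<^sub>R snd p) \<longlongrightarrow> a *\<^sub>R x) (nhds a \<times>\<^sub>F nhds x)"
    by (rule tendsto_scaleR)
next
  fix S :: "'a set"
  assume "open S" "0 \<in> S"
  then obtain e where "e > 0" "ball 0 e \<subseteq> S"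
    using open_contains_ball by blast
  then have "\<exists>V. open V \<and> convex V \<and> 0 \<in> V \<and> V \<subseteq> S"
    by (intro exI[of _ "ball 0 e"]) auto
  then show "\<exists>V. open V \<and>
      (\<forall>x\<in>V. \<forall>y\<in>V. \<forall>u\<ge>0. \<forall>v\<ge>0. u + v = 1 \<longrightarrow> u *\<^sub>R x + v *\<^sub>R y \<in> V) \<and> 0 \<in> V \<and> V \<subseteq> S"
    unfolding convex_def .
qed


section \<open>The topological dual with its weak* topology\<close>

typedef (overloaded) 'a dual =
  "{f :: 'a::locally_convex_t2 \<Rightarrow> real. linear f \<and> continuous_on UNIV f}"
  morphisms dual_apply Dual
  by (rule exI[of _ "\<lambda>_. 0"]) (simp add: linear_zero)

setup_lifting type_definition_dual

instantiation dual :: (locally_convex_t2) real_vector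
begin

lift_definition zero_dual :: "'a dual" is "\<lambda>_. 0"
  by (simp add: linear_zero)

lift_definition plus_dual :: "'a dual \<Rightarrow> 'a dual \<Rightarrow> 'a dual" is "\<lambda>f g x. f x + g x"
  by (simp add: linear_compose_add continuous_on_add)

lift_definition minus_dual :: "'a dual \<Rightarrow> 'a dual \<Rightarrow> 'a dual" is "\<lambda>f g x. f x - g x"
  by (simp add: linear_compose_sub continuous_on_diff)

lift_definition uminus_dual :: "'a dual \<Rightarrow> 'a dual" is "\<lambda>f x. - f x"
  by (simp add: linear_compose_neg continuous_on_minus)

lift_definition scaleR_dual :: "real \<Rightarrow> 'a dual \<Rightarrow> 'a dual" is "\<lambda>c f x. c * f x"
  using linear_compose_scale_right[where 'b = real]
  by (auto intro!: continuous_intros simp flip: real_scaleR_def)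

instance
  by standard (transfer; simp add: fun_eq_iff algebra_simps)+

end

text \<open>
  On functions, \<^term>\<open>open\<close> is the product topology, i.e. pointwise convergence; the weak*
  topology is the one it induces on the dual.
\<close>

instantiation dual :: (locally_convex_t2) topological_space
begin

definition open_dual :: "'a dual set \<Rightarrow> bool" where
  "open_dual S \<longleftrightarrow> (\<exists>T :: ('a \<Rightarrow> real) set. open T \<and> S = dual_apply -` T)"

instance
proof
  show "open (UNIV :: 'a dual set)"
    unfolding open_dual_def by (intro exI[of _ UNIV]) auto
next
  fix S T :: "'a dual set"
  assume "open S" "open T"
  then obtain S' T' where "open S'" "S = dual_apply -` S'" "open T'" "T = dual_apply -` T'"
    unfolding open_dual_def by blast
  then show "open (S \<inter> T)"
    unfolding open_dual_def by (intro exI[of _ "S' \<inter> T'"]) auto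
next
  fix K :: "'a dual set set"
  assume "\<forall>S\<in>K. open S"
  then obtain t where "\<forall>S\<in>K. open (t S) \<and> S = dual_apply -` t S"
    unfolding open_dual_def by metis
  then show "open (\<Union>K)"
    unfolding open_dual_def by (intro exI[of _ "\<Union>(t ` K)"]) auto
qed

end


section \<open>Fenchel conjugates\<close>

text \<open>
  In both suprema the first term is finite, so no \<open>\<infinity> - \<infinity>\<close> occurs.
\<close>

definition conjugate ::
  "('a::locally_convex_t2 \<times> 'b::locally_convex_t2 \<Rightarrow> ereal) \<Rightarrow> 'a dual \<times> 'b dual \<Rightarrow> ereal" where
  "conjugate F = (\<lambda>(x', \<mu>). SUP (x, y)\<in>UNIV. ereal (dual_apply x' x + dual_apply \<mu> y) - F (x, y))"

definition biconjugate ::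
  "('a::locally_convex_t2 \<times> 'b::locally_convex_t2 \<Rightarrow> ereal) \<Rightarrow> 'a \<times> 'b \<Rightarrow> ereal" where
  "biconjugate F =
    (\<lambda>(x, y). SUP (x', \<mu>)\<in>UNIV. ereal (dual_apply x' x + dual_apply \<mu> y) - conjugate F (x', \<mu>))"


section \<open>The robust S-procedure\<close>

definition S_primal :: "'u set \<Rightarrow> ('u \<Rightarrow> 'a::locally_convex_t2 \<times> 'b::locally_convex_t2 \<Rightarrow> ereal) \<Rightarrow> bool" where
  "S_primal U G \<longleftrightarrow> (\<forall>x. (SUP u\<in>U. G u (x, 0)) \<ge> 0)"

definition S_dual :: "'u set \<Rightarrow> ('u \<Rightarrow> 'a::locally_convex_t2 \<times> 'b::locally_convex_t2 \<Rightarrow> ereal) \<Rightarrow> bool" where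
  "S_dual U G \<longleftrightarrow>
    (\<exists>u\<in>U. \<exists>l :: 'b dual. \<forall>x y. G u (x, y) + ereal (dual_apply l y) \<ge> 0)"

definition S_procedure_valid ::
  "'u set \<Rightarrow> ('u \<Rightarrow> 'a::locally_convex_t2 \<times> 'b::locally_convex_t2 \<Rightarrow> ereal) \<Rightarrow> bool" where
  "S_procedure_valid U G \<longleftrightarrow> (S_primal U G \<longrightarrow> S_dual U G)"

definition F_sharp ::
  "'u set \<Rightarrow> ('u \<Rightarrow> 'a::locally_convex_t2 \<times> 'b::locally_convex_t2 \<Rightarrow> ereal) \<Rightarrow> ('a dual \<times> real) set" where
  "F_sharp U F = {(x', s). \<exists>u\<in>U. \<exists>\<mu> :: 'b dual. conjugate (F u) (x', \<mu>) \<le> ereal s}"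

definition closed_convex_regarding :: "'v::{real_vector, topological_space} set \<Rightarrow> 'v set \<Rightarrow> bool" where
  "closed_convex_regarding C D \<longleftrightarrow> closure (convex hull C) \<inter> D = C \<inter> D"

end

theory Submission
  imports Defs
begin

text \<open>
  Statement (B), for the family and for its biconjugates alike, says that \<open>(0, 0) \<in> F_sharp U F\<close>,
  and \<open>SUP u. F_u** (x, 0)\<close> is the supremum of \<open>x'(x) - s\<close> over \<open>(x', s) \<in> F_sharp U F\<close>.
  Hence if \<open>(0, 0)\<close> is in the weak* closed convex hull of \<open>F_sharp U F\<close>, then (A) holds for the
  biconjugates. If it is not, some \<open>(x, \<alpha>)\<close> satisfies \<open>x'(x) + \<alpha> s \<ge> r > 0\<close> on \<open>F_sharp U F\<close>,
  and \<open>\<alpha> \<ge> 0\<close> since \<open>F_sharp U F\<close> is upward closed in \<open>s\<close>. If \<open>\<alpha> > 0\<close>, then (A) for the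
  biconjugates fails at \<open>- x / \<alpha>\<close>; if \<open>\<alpha> = 0\<close>, it fails at \<open>x\<^sub>0 - t x\<close> for large \<open>t\<close>, where
  \<open>x\<^sub>0\<close> is a point at which the supremum is not \<open>\<infinity>\<close>.
\<close>

lemma minus_le_real_iff: "ereal t - z \<le> ereal s \<longleftrightarrow> ereal (t - s) \<le> z"
  by (cases z) auto

section \<open>Weak* continuity and weak* neighbourhoods of zero\<close>

lemma linear_dual_apply: "linear (dual_apply f)"
  using dual_apply[of f] by simp

lemma continuous_on_dual_apply_at: "continuous_on UNIV (\<lambda>f. dual_apply f x)"
proof -
  have "open ((\<lambda>f. dual_apply f x) -` B)" if "open B" for B
  proof -
    have "open ((\<lambda>g :: 'a \<Rightarrow> real. g x) -` B)"
      by (rule open_vimage[OF that]) (rule continuous_on_product_coordinates)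
    then show ?thesis
      unfolding open_dual_def by (auto intro!: exI[of _ "(\<lambda>g. g x) -` B"])
  qed
  then show ?thesis
    by (simp add: continuous_on_open_vimage)
qed

text \<open>Basic open sets of the product topology restrict only finitely many coordinates, and the
  least of the finitely many radii serves them all.\<close>

lemma weak_star_nhd_0:
  fixes S :: "'a::locally_convex_t2 dual set"
  assumes "open S" "0 \<in> S"
  obtains A e where "finite A" "e > 0" "\<And>f. (\<And>x. x \<in> A \<Longrightarrow> \<bar>dual_apply f x\<bar> < e) \<Longrightarrow> f \<in> S"
proof -
  obtain T where T: "open T" "S = dual_apply -` T"
    using assms(1) unfolding open_dual_def by blast
  then have "openin (product_topology (\<lambda>_. euclidean) UNIV) T" "(\<lambda>_. 0) \<in> T"
    using assms(2) by (auto simp: open_fun_def zero_dual.rep_eq)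
  from product_topology_open_contains_basis[OF this]
  obtain V where V: "(\<lambda>_. 0) \<in> Pi\<^sub>E UNIV V" "\<And>i. open (V i)" "finite {i. V i \<noteq> UNIV}"
    "Pi\<^sub>E UNIV V \<subseteq> T"
    by auto
  have "\<exists>e>0. \<forall>y::real. \<bar>y\<bar> < e \<longrightarrow> y \<in> V x" for x
  proof -
    have "0 \<in> V x"
      using V(1) by (auto simp: PiE_iff)
    then show ?thesis
      using V(2)[of x] by (fastforce simp: open_dist dist_real_def)
  qed
  then obtain d where d: "\<And>x. d x > 0" "\<And>x y. \<bar>y\<bar> < d x \<Longrightarrow> y \<in> V x"
    by metis
  define A where "A = {i. V i \<noteq> UNIV}"
  \<comment> \<open>The inserted 1 keeps \<open>Min\<close> meaningful and positive when
    \<open>A\<close> is empty.\<close>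
  define e where "e = Min (insert 1 (d ` A))"
  have A: "finite A"
    using V(3) by (simp add: A_def)
  show thesis
  proof (rule that[OF A])
    show "e > 0"
      using A d(1) by (simp add: e_def)
    fix f assume f: "\<And>x. x \<in> A \<Longrightarrow> \<bar>dual_apply f x\<bar> < e"
    have "dual_apply f x \<in> V x" for x
    proof (cases "x \<in> A")
      case True
      then have "e \<le> d x"
        using A by (simp add: e_def)
      then show ?thesis
        using f[OF True] d(2) by force
    qed (auto simp: A_def)
    then have "dual_apply f \<in> T"
      using V(4) by (auto simp: PiE_iff)
    then show "f \<in> S"
      by (simp add: T(2))
  qed
qed

section \<open>Separation of the origin from a convex set\<close>

text \<open>
  The vector \<open>a\<close> is the point of least Euclidean norm in the closure of the image of \<open>C\<close> under
  \<open>(f i)\<^sub>i\<close>. It is built coordinatewise from a minimizing sequence, which is Cauchy by the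
  parallelogram law, because a Euclidean space of dimension \<open>card I\<close> is not available as a type.
\<close>

lemma finite_linear_separation:
  fixes C :: "'v::real_vector set" and f :: "'i \<Rightarrow> 'v \<Rightarrow> real"
  assumes I: "finite I" and lin: "\<And>i. i \<in> I \<Longrightarrow> linear (f i)"
    and C: "convex C" "C \<noteq> {}"
    and low: "\<And>c. c \<in> C \<Longrightarrow> r \<le> (\<Sum>i\<in>I. (f i c)\<^sup>2)"
  obtains a where "\<And>c. c \<in> C \<Longrightarrow> r \<le> (\<Sum>i\<in>I. a i * f i c)"
proof -
  define q where "q c = (\<Sum>i\<in>I. (f i c)\<^sup>2)" for c
  define d where "d = Inf (q ` C)"
  have bdd: "bdd_below (q ` C)"
    using low by (auto simp: bdd_below_def q_def)
  have dq: "d \<le> q c" if "c \<in> C" for c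
    unfolding d_def using bdd that by (simp add: cInf_lower)
  have rd: "r \<le> d"
    unfolding d_def using C(2) low by (auto intro!: cInf_greatest simp: q_def)
  have "\<exists>c\<in>C. q c < d + inverse (real (Suc n))" for n
    using C(2) bdd cInf_less_iff[of "q ` C" "d + inverse (real (Suc n))"] by (auto simp: d_def)
  then obtain c where c: "\<And>n. c n \<in> C" "\<And>n. q (c n) < d + inverse (real (Suc n))"
    by metis
  \<comment> \<open>By linearity the segment between two image points is the image of a segment in
    \<open>C\<close>. Its midpoint serves in \<open>par\<close>; in \<open>var\<close> one endpoint
    runs through the minimizing sequence.\<close>
  have comb: "(\<Sum>i\<in>I. ((1 - t) * f i x + t * f i y)\<^sup>2) \<ge> d"
    if "x \<in> C" "y \<in> C" "0 \<le> t" "t \<le> 1" for x y t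
  proof -
    have "(1 - t) *\<^sub>R x + t *\<^sub>R y \<in> C"
      using C(1) that by (auto simp: convex_alt)
    then have "d \<le> q ((1 - t) *\<^sub>R x + t *\<^sub>R y)"
      by (rule dq)
    also have "\<dots> = (\<Sum>i\<in>I. ((1 - t) * f i x + t * f i y)\<^sup>2)"
      unfolding q_def by (intro sum.cong) (simp_all add: linear_add[OF lin] linear_scale[OF lin])
    finally show ?thesis .
  qed
  \<comment> \<open>Parallelogram identity summed over \<open>I\<close>: the midpoint has squared
    norm at least \<open>d\<close>, while both endpoints nearly attain \<open>d\<close>.\<close>
  have par: "(f i (c m) - f i (c n))\<^sup>2 \<le> 2 * inverse (real (Suc m)) + 2 * inverse (real (Suc n))"
    if "i \<in> I" for i m n
  proof -
    have "(f i (c m) - f i (c n))\<^sup>2 \<le> (\<Sum>i\<in>I. (f i (c m) - f i (c n))\<^sup>2)"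
      using that I by (intro member_le_sum) auto
    also have "\<dots> = (\<Sum>i\<in>I. 2 * (f i (c m))\<^sup>2 + 2 * (f i (c n))\<^sup>2
        - 4 * ((1 - 1/2) * f i (c m) + 1/2 * f i (c n))\<^sup>2)"
      by (intro sum.cong) (simp_all add: power2_eq_square algebra_simps)
    also have "\<dots> = 2 * q (c m) + 2 * q (c n)
        - 4 * (\<Sum>i\<in>I. ((1 - 1/2) * f i (c m) + 1/2 * f i (c n))\<^sup>2)"
      by (simp only: q_def sum.distrib sum_subtractf sum_distrib_left)
    also have "\<dots> \<le> 2 * q (c m) + 2 * q (c n) - 4 * d"
      using comb[OF c(1) c(1), of "1/2" m n] by simp
    also have "\<dots> \<le> 2 * inverse (real (Suc m)) + 2 * inverse (real (Suc n))"
      using c(2)[of m] c(2)[of n] by simp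
    finally show ?thesis .
  qed
  have "\<exists>l. (\<lambda>n. f i (c n)) \<longlonglongrightarrow> l" if "i \<in> I" for i
  proof -
    have "Cauchy (\<lambda>n. f i (c n))"
    proof (rule metric_CauchyI)
      fix e :: real assume "e > 0"
      then obtain N where N: "inverse (real (Suc N)) < e\<^sup>2 / 4"
        using reals_Archimedean[of "e\<^sup>2 / 4"] by auto
      have "dist (f i (c m)) (f i (c n)) < e" if "m \<ge> N" "n \<ge> N" for m n
      proof -
        have "inverse (real (Suc m)) \<le> inverse (real (Suc N))"
          "inverse (real (Suc n)) \<le> inverse (real (Suc N))"
          using that by (auto intro!: le_imp_inverse_le)
        then have "(f i (c m) - f i (c n))\<^sup>2 < e\<^sup>2"
          using par[OF \<open>i \<in> I\<close>, of m n] N by linarith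
        then show ?thesis
          using \<open>e > 0\<close> power2_less_imp_less[of "\<bar>f i (c m) - f i (c n)\<bar>" e]
          by (simp add: dist_real_def)
      qed
      then show "\<exists>N. \<forall>m\<ge>N. \<forall>n\<ge>N. dist (f i (c m)) (f i (c n)) < e"
        by blast
    qed
    then show ?thesis
      by (simp add: Cauchy_convergent_iff convergent_def)
  qed
  then obtain a where a: "\<And>i. i \<in> I \<Longrightarrow> (\<lambda>n. f i (c n)) \<longlonglongrightarrow> a i"
    by metis
  have "(\<lambda>n. q (c n)) \<longlonglongrightarrow> (\<Sum>i\<in>I. (a i)\<^sup>2)"
    unfolding q_def by (intro tendsto_intros a)
  then have da: "d \<le> (\<Sum>i\<in>I. (a i)\<^sup>2)"
    by (rule LIMSEQ_le_const) (use dq c(1) in blast)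
  have "(\<lambda>n. d + inverse (real (Suc n))) \<longlonglongrightarrow> d + 0"
    by (intro tendsto_intros LIMSEQ_inverse_real_of_nat)
  with \<open>(\<lambda>n. q (c n)) \<longlonglongrightarrow> (\<Sum>i\<in>I. (a i)\<^sup>2)\<close> have ad: "(\<Sum>i\<in>I. (a i)\<^sup>2) \<le> d"
    using LIMSEQ_le[of "\<lambda>n. q (c n)" _ "\<lambda>n. d + inverse (real (Suc n))" "d + 0"] c(2)
    by (auto intro: less_imp_le)
  have "r \<le> (\<Sum>i\<in>I. a i * f i y)" if y: "y \<in> C" for y
  proof -
    define g where "g = (\<Sum>i\<in>I. a i * (f i y - a i))"
    define h where "h = (\<Sum>i\<in>I. (f i y - a i)\<^sup>2)"
    \<comment> \<open>On the segment from \<open>a\<close> to the image of \<open>y\<close> the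
      squared norm stays at least \<open>d\<close>, hence at least that of \<open>a\<close>. Its
      expansion in \<open>t\<close> has slope \<open>2 * g\<close> at 0.\<close>
    have var: "0 \<le> 2 * t * g + t\<^sup>2 * h" if t: "0 \<le> t" "t \<le> 1" for t
    proof -
      have "(\<lambda>n. \<Sum>i\<in>I. ((1 - t) * f i (c n) + t * f i y)\<^sup>2)
          \<longlonglongrightarrow> (\<Sum>i\<in>I. ((1 - t) * a i + t * f i y)\<^sup>2)"
        by (intro tendsto_intros a)
      then have "d \<le> (\<Sum>i\<in>I. ((1 - t) * a i + t * f i y)\<^sup>2)"
        by (rule LIMSEQ_le_const) (use comb[OF c(1) y t] in blast)
      also have "\<dots> = (\<Sum>i\<in>I. (a i)\<^sup>2 + 2 * t * (a i * (f i y - a i)) + t\<^sup>2 * (f i y - a i)\<^sup>2)"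
        by (intro sum.cong) (simp_all add: power2_eq_square algebra_simps)
      also have "\<dots> = (\<Sum>i\<in>I. (a i)\<^sup>2) + 2 * t * g + t\<^sup>2 * h"
        by (simp only: g_def h_def sum.distrib sum_distrib_left)
      finally show ?thesis
        using ad by simp
    qed
    have "0 \<le> g"
    proof (rule ccontr)
      assume "\<not> 0 \<le> g"
      then have g: "g < 0" by simp
      have h: "0 \<le> h"
        by (simp add: h_def sum_nonneg)
      \<comment> \<open>Here \<open>2 * g + t * h = g + t * g < 0\<close>, which contradicts
        \<open>var\<close>; the denominator is positive even if \<open>h = 0\<close>.\<close>
      define t where "t = - g / (h - g)"
      have t: "0 < t" "t \<le> 1" "t * (h - g) = - g"
        using g h by (auto simp: t_def field_simps)
      have "0 \<le> t * (2 * g + t * h)"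
        using var[of t] t by (simp add: power2_eq_square algebra_simps)
      then have "0 \<le> 2 * g + t * h"
        using t(1) by (simp add: zero_le_mult_iff)
      moreover have "t * h = - g + t * g"
        using t(3) by (simp add: algebra_simps)
      moreover have "t * g < 0"
        using t(1) g by (rule mult_pos_neg)
      ultimately show False
        using g by linarith
    qed
    moreover have "g = (\<Sum>i\<in>I. a i * f i y) - (\<Sum>i\<in>I. (a i)\<^sup>2)"
      by (simp add: g_def right_diff_distrib sum_subtractf power2_eq_square)
    ultimately show ?thesis
      using rd da by linarith
  qed
  then show thesis
    by (rule that)
qed

text \<open>A basic neighbourhood of the origin that misses \<open>C\<close> tests finitely many
  evaluations and the real coordinate, so at each point of \<open>C\<close> one of these is at least
  \<open>m\<close> in modulus. This is the setting of \<open>finite_linear_separation\<close>, and a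
  linear combination of evaluations is again evaluation at a point.\<close>

lemma weak_star_separation_0:
  fixes C :: "('a::locally_convex_t2 dual \<times> real) set"
  assumes C: "convex C" "C \<noteq> {}" and cl: "(0, 0) \<notin> closure C"
  obtains x \<alpha> r where "r > 0" "\<And>f s. (f, s) \<in> C \<Longrightarrow> r \<le> dual_apply f x + \<alpha> * s"
proof -
  have "open (- closure C)" "(0, 0) \<in> - closure C"
    using cl by auto
  then obtain S B where SB: "open S" "open B" "0 \<in> S" "0 \<in> B" "S \<times> B \<subseteq> - closure C"
    by (auto elim!: open_prod_elim)
  obtain A d where A: "finite A" "d > 0"
    "\<And>f. (\<And>x. x \<in> A \<Longrightarrow> \<bar>dual_apply f x\<bar> < d) \<Longrightarrow> f \<in> S"
    using weak_star_nhd_0[OF SB(1,3)] by blast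
  obtain d' where d': "d' > 0" "\<And>s::real. \<bar>s\<bar> < d' \<Longrightarrow> s \<in> B"
    using SB(2,4) by (fastforce simp: open_dist dist_real_def)
  define m where "m = min d d'"
  have m: "m > 0" "m \<le> d" "m \<le> d'"
    using A(2) d'(1) by (auto simp: m_def)
  \<comment> \<open>\<open>None\<close> indexes the real coordinate, \<open>Some x\<close> the
    evaluation at \<open>x\<close>.\<close>
  define I where "I = insert None (Some ` A)"
  define \<phi> where "\<phi> i p = (case i of None \<Rightarrow> snd p | Some x \<Rightarrow> dual_apply (fst p) x)"
    for i and p :: "'a dual \<times> real"
  have I: "finite I"
    using A(1) by (simp add: I_def)
  have lin: "linear (\<phi> i)" for i
    by (cases i; intro linearI) (simp_all add: \<phi>_def plus_dual.rep_eq scaleR_dual.rep_eq)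
  have low: "m\<^sup>2 \<le> (\<Sum>i\<in>I. (\<phi> i p)\<^sup>2)" if p: "p \<in> C" for p
  proof -
    have "p \<notin> S \<times> B"
      using p SB(5) closure_subset by blast
    then have "\<exists>i\<in>I. m \<le> \<bar>\<phi> i p\<bar>"
      using A(3)[of "fst p"] d'(2)[of "snd p"] m
      by (cases p) (force simp: I_def \<phi>_def not_less)
    then obtain i where i: "i \<in> I" "m \<le> \<bar>\<phi> i p\<bar>" ..
    then have "m\<^sup>2 \<le> (\<phi> i p)\<^sup>2"
      using m(1) power_mono[of m "\<bar>\<phi> i p\<bar>" 2] by simp
    also have "\<dots> \<le> (\<Sum>i\<in>I. (\<phi> i p)\<^sup>2)"
      using i(1) I by (intro member_le_sum) auto
    finally show ?thesis .
  qed
  obtain a where a: "\<And>p. p \<in> C \<Longrightarrow> m\<^sup>2 \<le> (\<Sum>i\<in>I. a i * \<phi> i p)"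
    using finite_linear_separation[of I \<phi> C "m\<^sup>2"] I lin C low by blast
  show thesis
  proof (rule that)
    show "m\<^sup>2 > 0"
      using m(1) by simp
    fix f s assume "(f, s) \<in> C"
    from a[OF this] have "m\<^sup>2 \<le> a None * s + (\<Sum>x\<in>A. a (Some x) * dual_apply f x)"
      using A(1) by (simp add: I_def \<phi>_def sum.reindex)
    also have "\<dots> = dual_apply f (\<Sum>x\<in>A. a (Some x) *\<^sub>R x) + a None * s"
      using linear_dual_apply[of f] by (simp add: linear_sum linear_scale)
    finally show "m\<^sup>2 \<le> dual_apply f (\<Sum>x\<in>A. a (Some x) *\<^sub>R x) + a None * s" .
  qed
qed

section \<open>Affine minorants and biconjugates\<close>

text \<open>Reads the epigraph of the conjugate as the set of continuous affine minorants of
  \<open>F\<close>, the form in which conjugates are used below.\<close>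

lemma conjugate_le_iff:
  "conjugate F (x', \<mu>) \<le> ereal s \<longleftrightarrow>
    (\<forall>x y. ereal (dual_apply x' x + dual_apply \<mu> y - s) \<le> F (x, y))"
  by (auto simp: conjugate_def SUP_le_iff minus_le_real_iff)

lemma biconjugate_le: "biconjugate F p \<le> F p"
proof -
  obtain x y where p: "p = (x, y)" by fastforce
  have "ereal (dual_apply x' x + dual_apply \<mu> y) - conjugate F (x', \<mu>) \<le> F (x, y)" for x' \<mu>
  proof (cases "conjugate F (x', \<mu>)")
    case (real r)
    then show ?thesis
      using conjugate_le_iff[of F x' \<mu> r] by simp
  next
    \<comment> \<open>A conjugate equal to minus infinity yields affine minorants with arbitrarily
      large constant term, so \<open>F\<close> is infinite at the point.\<close>
    case MInf
    then have "ereal (dual_apply x' x + dual_apply \<mu> y - s) \<le> F (x, y)" for s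
      using conjugate_le_iff[of F x' \<mu> s] by simp
    from this[of "dual_apply x' x + dual_apply \<mu> y - t" for t] have "ereal t \<le> F (x, y)" for t
      by simp
    then have "F (x, y) = \<infinity>"
      using ereal_top by blast
    then show ?thesis by simp
  qed simp
  then show ?thesis
    unfolding biconjugate_def p by (auto intro!: SUP_least)
qed

lemma le_biconjugate:
  assumes "conjugate F (x', \<mu>) \<le> ereal s"
  shows "ereal (dual_apply x' x + dual_apply \<mu> y - s) \<le> biconjugate F (x, y)"
proof -
  have "ereal (dual_apply x' x + dual_apply \<mu> y - s)
      \<le> ereal (dual_apply x' x + dual_apply \<mu> y) - conjugate F (x', \<mu>)"
    using assms by (cases "conjugate F (x', \<mu>)") auto
  also have "\<dots> \<le> biconjugate F (x, y)"
    unfolding biconjugate_def by (auto intro!: SUP_upper2[of "(x', \<mu>)"])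
  finally show ?thesis .
qed

section \<open>Statements (A) and (B) in terms of \<open>F_sharp\<close>\<close>

text \<open>A function and its biconjugate have the same continuous affine minorants.\<close>

lemma F_sharp_biconjugate:
  fixes F :: "'u \<Rightarrow> 'a::locally_convex_t2 \<times> 'b::locally_convex_t2 \<Rightarrow> ereal"
  shows "F_sharp U (\<lambda>u. biconjugate (F u)) = F_sharp U F"
proof -
  have "conjugate (biconjugate G) (x', \<mu>) \<le> ereal s \<longleftrightarrow> conjugate G (x', \<mu>) \<le> ereal s"
    for G :: "'a \<times> 'b \<Rightarrow> ereal" and x' \<mu> s
    using le_biconjugate[of G x' \<mu> s] order_trans[OF _ biconjugate_le[of G]]
    by (auto simp: conjugate_le_iff)
  then show ?thesis
    by (simp add: F_sharp_def)
qed

text \<open>In (B) the functional \<open>- l\<close>, together with x' = 0 and s = 0, gives an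
  affine minorant; negation is a bijection of the dual.\<close>

lemma S_dual_iff:
  fixes F :: "'u \<Rightarrow> 'a::locally_convex_t2 \<times> 'b::locally_convex_t2 \<Rightarrow> ereal"
  shows "S_dual U F \<longleftrightarrow> (0, 0) \<in> F_sharp U F"
proof -
  have "(\<exists>l. \<forall>x y. G (x, y) + ereal (dual_apply l y) \<ge> 0) \<longleftrightarrow> (\<exists>\<mu>. conjugate G (0, \<mu>) \<le> ereal 0)"
    (is "?L \<longleftrightarrow> ?R") for G :: "'a \<times> 'b \<Rightarrow> ereal"
  proof -
    have *: "0 \<le> z + ereal t \<longleftrightarrow> ereal (- t) \<le> z" for z t
      by (cases z) auto
    have "?L \<longleftrightarrow> (\<exists>l. conjugate G (0, - l) \<le> ereal 0)"
      by (simp add: * conjugate_le_iff zero_dual.rep_eq uminus_dual.rep_eq)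
    also have "\<dots> \<longleftrightarrow> ?R"
      by (metis minus_minus)
    finally show ?thesis .
  qed
  then show ?thesis
    by (simp add: S_dual_def F_sharp_def)
qed

text \<open>Brings (A) into the form to which the equality of the two infima applies.\<close>

lemma S_primal_iff_INF: "S_primal U G \<longleftrightarrow> 0 \<le> (INF x. SUP u\<in>U. G u (x, 0))"
  by (simp add: S_primal_def le_INF_iff)

text \<open>At y = 0 the multiplier \<open>\<mu>\<close> contributes nothing, so only its existence
  matters, which is what \<open>F_sharp\<close> records.\<close>

lemma SUP_biconjugate_le_iff:
  "(SUP u\<in>U. biconjugate (F u) (x, 0)) \<le> ereal a \<longleftrightarrow>
    (\<forall>(x', s)\<in>F_sharp U F. dual_apply x' x - s \<le> a)"
proof
  assume L: "(SUP u\<in>U. biconjugate (F u) (x, 0)) \<le> ereal a"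
  have "dual_apply x' x - s \<le> a" if "u \<in> U" "conjugate (F u) (x', \<mu>) \<le> ereal s" for u x' \<mu> s
  proof -
    have "ereal (dual_apply x' x + dual_apply \<mu> 0 - s) \<le> biconjugate (F u) (x, 0)"
      using that(2) by (rule le_biconjugate)
    also have "\<dots> \<le> ereal a"
      using L that(1) by (simp add: SUP_le_iff)
    finally show ?thesis
      by (simp add: linear_0[OF linear_dual_apply])
  qed
  then show "\<forall>(x', s)\<in>F_sharp U F. dual_apply x' x - s \<le> a"
    by (auto simp: F_sharp_def)
next
  assume R: "\<forall>(x', s)\<in>F_sharp U F. dual_apply x' x - s \<le> a"
  have "ereal (dual_apply x' x) - conjugate (F u) (x', \<mu>) \<le> ereal a" if "u \<in> U" for u x' \<mu>
  proof (cases "conjugate (F u) (x', \<mu>)")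
    case (real r)
    then have "(x', r) \<in> F_sharp U F"
      using that by (auto simp: F_sharp_def intro!: bexI[of _ u] exI[of _ \<mu>])
    then show ?thesis
      using R real by auto
  next
    \<comment> \<open>Every real \<open>s\<close> is now admissible; this one makes x'(x) - s equal
      to \<open>a + 1\<close>, which contradicts \<open>R\<close>.\<close>
    case MInf
    then have "(x', dual_apply x' x - a - 1) \<in> F_sharp U F"
      using that by (auto simp: F_sharp_def intro!: bexI[of _ u] exI[of _ \<mu>])
    then show ?thesis
      using R by auto
  qed simp
  then show "(SUP u\<in>U. biconjugate (F u) (x, 0)) \<le> ereal a"
    by (auto simp: biconjugate_def linear_0[OF linear_dual_apply] intro!: SUP_least)
qed

section \<open>Statement (A) and the weak* closed convex hull\<close>

text \<open>A failure of (A) at \<open>x\<close> places \<open>F_sharp U F\<close> in a weak* closed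
  half-space \<open>H\<close> that excludes the origin, since its bound \<open>a\<close> is
  negative.\<close>

lemma S_primal_biconjugate_if_closure:
  fixes F :: "'u \<Rightarrow> 'a::locally_convex_t2 \<times> 'b::locally_convex_t2 \<Rightarrow> ereal"
  assumes "(0, 0) \<in> closure (convex hull (F_sharp U F))"
  shows "S_primal U (\<lambda>u. biconjugate (F u))"
  unfolding S_primal_def
proof (rule allI, rule ccontr)
  fix x assume "\<not> 0 \<le> (SUP u\<in>U. biconjugate (F u) (x, 0))"
  then have "(SUP u\<in>U. biconjugate (F u) (x, 0)) < 0"
    by (simp only: not_le)
  from ereal_dense2[OF this]
  obtain a where "(SUP u\<in>U. biconjugate (F u) (x, 0)) < ereal a" "ereal a < 0"
    by blast
  then have a: "(SUP u\<in>U. biconjugate (F u) (x, 0)) \<le> ereal a" "a < 0"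
    by (simp_all only: less_imp_le ereal_less)
  define H where "H = {p. dual_apply (fst p) x - snd p \<le> a}"
  have "continuous_on UNIV (\<lambda>p :: 'a dual \<times> real. dual_apply (fst p) x)"
    by (rule continuous_on_compose2[OF continuous_on_dual_apply_at[of x]])
      (auto intro: continuous_intros)
  then have "closed H"
    unfolding H_def by (intro closed_Collect_le continuous_intros)
  moreover have "linear (\<lambda>p :: 'a dual \<times> real. dual_apply (fst p) x - snd p)"
    by (rule linearI) (simp_all add: plus_dual.rep_eq scaleR_dual.rep_eq algebra_simps)
  then have "convex H"
    using convex_linear_vimage[of _ "{..a}"] by (auto simp: H_def vimage_def)
  moreover have "F_sharp U F \<subseteq> H"
    using a(1) by (auto simp: SUP_biconjugate_le_iff H_def)
  ultimately have "closure (convex hull (F_sharp U F)) \<subseteq> H"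
    by (intro closure_minimal hull_minimal)
  then show False
    using assms a(2) by (auto simp: H_def zero_dual.rep_eq)
qed

text \<open>Rules out a negative coefficient of the real coordinate in the separation below.\<close>

lemma F_sharp_upward:
  assumes "(x', s) \<in> F_sharp U F" "s \<le> t"
  shows "(x', t) \<in> F_sharp U F"
proof -
  have "ereal s \<le> ereal t"
    using assms(2) by simp
  with assms(1) show ?thesis
    unfolding F_sharp_def by (blast intro: order_trans)
qed

lemma closure_if_S_primal_biconjugate:
  assumes primal: "S_primal U (\<lambda>u. biconjugate (F u))"
    and fin: "(INF x. SUP u\<in>U. biconjugate (F u) (x, 0)) \<noteq> \<infinity>"
  shows "(0, 0) \<in> closure (convex hull (F_sharp U F))"
proof (rule ccontr)
  assume not_cl: "(0, 0) \<notin> closure (convex hull (F_sharp U F))"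
  \<comment> \<open>Each case below ends by exhibiting a point \<open>x\<close> at which (A) for the
    biconjugates would fail.\<close>
  have no: False if "\<And>x' s. (x', s) \<in> F_sharp U F \<Longrightarrow> dual_apply x' x - s \<le> a" "a < 0" for x a
  proof -
    have "(SUP u\<in>U. biconjugate (F u) (x, 0)) \<le> ereal a"
      using that(1) by (auto simp: SUP_biconjugate_le_iff)
    moreover have "0 \<le> (SUP u\<in>U. biconjugate (F u) (x, 0))"
      using primal by (simp add: S_primal_def)
    ultimately have "0 \<le> ereal a"
      by (rule order_trans[rotated])
    with that(2) show False
      by simp
  qed
  \<comment> \<open>If \<open>F_sharp U F\<close> were empty, the bound -1 would hold
    vacuously.\<close>
  obtain x1 s1 where p1: "(x1, s1) \<in> F_sharp U F"
    using no[of _ "-1"] by fastforce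
  then have "convex hull (F_sharp U F) \<noteq> {}"
    by auto
  then obtain x \<alpha> r where r: "r > 0"
    and sep_hull: "\<And>f s. (f, s) \<in> convex hull (F_sharp U F) \<Longrightarrow> r \<le> dual_apply f x + \<alpha> * s"
    by (rule weak_star_separation_0[OF convex_convex_hull _ not_cl]) rule
  have sep: "r \<le> dual_apply f x + \<alpha> * s" if "(f, s) \<in> F_sharp U F" for f s
    using sep_hull hull_inc[OF that] by blast
  have "\<alpha> \<ge> 0"
  proof (rule ccontr)
    assume "\<not> \<alpha> \<ge> 0"
    then have \<alpha>: "\<alpha> < 0" by simp
    \<comment> \<open>Large enough that the separating functional is at most 0 at
      \<open>(x1, t)\<close>, yet still at least \<open>s1\<close>.\<close>
    define t where "t = max s1 (dual_apply x1 x / - \<alpha>)"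
    have "r \<le> dual_apply x1 x + \<alpha> * t"
      by (rule sep, rule F_sharp_upward[OF p1]) (simp add: t_def)
    also have "\<dots> \<le> dual_apply x1 x + \<alpha> * (dual_apply x1 x / - \<alpha>)"
      using \<alpha> by (intro add_left_mono mult_left_mono_neg) (auto simp: t_def)
    also have "\<dots> = 0"
      using \<alpha> by simp
    finally show False
      using r by simp
  qed
  show False
  proof (cases "\<alpha> = 0")
    case False
    with \<open>\<alpha> \<ge> 0\<close> have \<alpha>: "\<alpha> > 0" by simp
    show False
    proof (rule no[of "(- 1 / \<alpha>) *\<^sub>R x" "- r / \<alpha>"])
      show "dual_apply f ((- 1 / \<alpha>) *\<^sub>R x) - s \<le> - r / \<alpha>" if "(f, s) \<in> F_sharp U F" for f s
        using divide_right_mono[OF sep[OF that], of \<alpha>] \<alpha>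
        unfolding linear_scale[OF linear_dual_apply] by (simp add: add_divide_distrib)
      show "- r / \<alpha> < 0"
        using r \<alpha> by simp
    qed
  next
    case True
    have "\<exists>x0. (SUP u\<in>U. biconjugate (F u) (x0, 0)) \<noteq> \<infinity>"
    proof (rule ccontr)
      assume "\<nexists>x0. (SUP u\<in>U. biconjugate (F u) (x0, 0)) \<noteq> \<infinity>"
      then have "(INF x. SUP u\<in>U. biconjugate (F u) (x, 0)) = \<infinity>"
        by simp
      with fin show False ..
    qed
    then obtain x0 where "(SUP u\<in>U. biconjugate (F u) (x0, 0)) \<noteq> \<infinity>"
      by blast
    then obtain M where "(SUP u\<in>U. biconjugate (F u) (x0, 0)) \<le> ereal M"
      by (cases "SUP u\<in>U. biconjugate (F u) (x0, 0)") auto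
    then have M: "dual_apply f x0 - s \<le> M" if "(f, s) \<in> F_sharp U F" for f s
      using that by (auto simp: SUP_biconjugate_le_iff)
    \<comment> \<open>Moving from \<open>x0\<close> by \<open>- t *\<^sub>R x\<close> lowers each
      value by at least \<open>t * r = \<bar>M\<bar> + 1\<close>, which brings the bound
      \<open>M\<close> down to -1.\<close>
    define t where "t = (\<bar>M\<bar> + 1) / r"
    show False
    proof (rule no[of "x0 - t *\<^sub>R x" "-1"])
      show "dual_apply f (x0 - t *\<^sub>R x) - s \<le> -1" if p: "(f, s) \<in> F_sharp U F" for f s
      proof -
        have "t * r \<le> t * dual_apply f x"
          using sep[OF p] True r by (intro mult_left_mono) (auto simp: t_def)
        moreover have "t * r = \<bar>M\<bar> + 1"
          using r by (simp add: t_def)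
        ultimately show ?thesis
          using M[OF p]
          by (simp add: linear_diff[OF linear_dual_apply] linear_scale[OF linear_dual_apply])
      qed
    qed simp
  qed
qed

section \<open>Comparison of the three statements\<close>

theorem theorem2:
  fixes U :: "'u set"
    and F :: "'u \<Rightarrow> 'x::locally_convex_t2 \<times> 'y::locally_convex_t2 \<Rightarrow> ereal"
  shows "(S_procedure_valid U F \<longrightarrow> S_procedure_valid U (\<lambda>u. biconjugate (F u))) \<and>
    (S_procedure_valid U (\<lambda>u. biconjugate (F u)) \<longrightarrow>
       closed_convex_regarding (F_sharp U F) {(0, 0)}) \<and>
    ((INF x. SUP u\<in>U. F u (x, 0)) = (INF x. SUP u\<in>U. biconjugate (F u) (x, 0)) \<and>
     (INF x. SUP u\<in>U. biconjugate (F u) (x, 0)) \<noteq> \<infinity> \<longrightarrow>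
       (S_procedure_valid U F \<longleftrightarrow> S_procedure_valid U (\<lambda>u. biconjugate (F u))) \<and>
       (S_procedure_valid U (\<lambda>u. biconjugate (F u)) \<longleftrightarrow>
          closed_convex_regarding (F_sharp U F) {(0, 0)}))"
proof -
  let ?B = "\<lambda>u. biconjugate (F u)" and ?K = "closure (convex hull (F_sharp U F))"
  have dual: "S_dual U ?B \<longleftrightarrow> S_dual U F"
    by (simp add: S_dual_iff F_sharp_biconjugate)
  \<comment> \<open>Passing to biconjugates strengthens (A) and leaves (B) unchanged, so validity is
    inherited.\<close>
  have "(SUP u\<in>U. biconjugate (F u) (x, 0)) \<le> (SUP u\<in>U. F u (x, 0))" for x
    by (intro SUP_mono' biconjugate_le)
  then have "S_primal U ?B \<Longrightarrow> S_primal U F"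
    unfolding S_primal_def by (meson order_trans)
  then have i_ii: "S_procedure_valid U F \<longrightarrow> S_procedure_valid U ?B"
    by (simp add: S_procedure_valid_def dual)
  have "F_sharp U F \<subseteq> ?K"
    by (meson closure_subset hull_subset order_trans)
  \<comment> \<open>For a singleton, closedness regarding it only concerns membership of the origin,
    and that membership in \<open>F_sharp U F\<close> is (B).\<close>
  then have iii: "closed_convex_regarding (F_sharp U F) {(0, 0)} \<longleftrightarrow>
      ((0, 0) \<in> ?K \<longrightarrow> S_dual U F)"
    unfolding closed_convex_regarding_def S_dual_iff by blast
  have ii_iii: "S_procedure_valid U ?B \<longrightarrow> closed_convex_regarding (F_sharp U F) {(0, 0)}"
    using S_primal_biconjugate_if_closure[of U F] by (simp add: iii S_procedure_valid_def dual)
  have "(S_procedure_valid U F \<longleftrightarrow> S_procedure_valid U ?B) \<and>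
      (S_procedure_valid U ?B \<longleftrightarrow> closed_convex_regarding (F_sharp U F) {(0, 0)})"
    if eq: "(INF x. SUP u\<in>U. F u (x, 0)) = (INF x. SUP u\<in>U. biconjugate (F u) (x, 0))"
      and fin: "(INF x. SUP u\<in>U. biconjugate (F u) (x, 0)) \<noteq> \<infinity>"
  proof
    have "S_primal U F \<longleftrightarrow> S_primal U ?B"
      by (simp add: S_primal_iff_INF eq)
    then show "S_procedure_valid U F \<longleftrightarrow> S_procedure_valid U ?B"
      by (simp add: S_procedure_valid_def dual)
    show "S_procedure_valid U ?B \<longleftrightarrow> closed_convex_regarding (F_sharp U F) {(0, 0)}"
      using ii_iii closure_if_S_primal_biconjugate[of U F] fin
      by (auto simp: iii S_procedure_valid_def dual)
  qed
  with i_ii ii_iii show ?thesis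
    by blast
qed

end
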